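(* Let $X\in\mathbb R^{2n\times 2n}$ be symmetric positive definite, let $J_{2n}=X^{1/2}\mathbb J_{2n}X^{1/2}$, and let $\tilde A_{2k}=[e_1|\dots|e_k|Te_1|\dots|Te_k]\in\mathbb R^{2n\times 2k}$ be a basis generated after $k\ge 1$ steps by the greedy method for constructing a $J_{2n}$-symplectic basis (the method is described in the context). Then $\tilde A_{2k}$ is orthonormal with respect to the $X$-norm, i.e. $\tilde A_{2k}^T X \tilde A_{2k}=I_{2k}$.
   Context: For $m\ge 1$, $\mathbb J_{2m}=\begin{pmatrix}0_m & I_m\\ -I_m & 0_m\end{pmatrix}\in\mathbb R^{2m\times 2m}$, where $0_m$ and $I_m$ are the $m\times m$ zero and identity matrices. For a symmetric positive definite matrix $X\in\mathbb R^{2n\times 2n}$, $X^{1/2}$ is its symmetric positive definite square root, $X^{-1/2}$ is the inverse of $X^{1/2}$, $\langle x,y\rangle_X=x^TXy$, and $\|x\|_X=\sqrt{\langle x,x\rangle_X}$. Put $J_{2n}=X^{1/2}\mathbb J_{2n}X^{1/2}$ (a full-rank skew-symmetric matrix), $\Omega_{J_{2n}}(x,y)=x^TJ_{2n}y$ for $x,y\in\mathbb R^{2n}$, and $T=X^{-1/2}\mathbb J_{2n}^TX^{1/2}$. A matrix $B\in\mathbb R^{2n\times 2k}$ is called $J_{2n}$-symplectic if $B^TJ_{2n}B=\mathbb J_{2k}$. Greedy method (symplectic Gram-Schmidt construction). Start with a nonzero vector $z_0\in\mathbb R^{2n}$, set $e_1=z_0/\|z_0\|_X$ and $\tilde A_2=[e_1|Te_1]$.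 Given $\tilde A_{2k}=[e_1|\dots|e_k|Te_1|\dots|Te_k]$, a vector $z\in\mathbb R^{2n}$ with $z\notin\mathrm{colspan}(\tilde A_{2k})$ is provided (selected from a given finite set of snapshot vectors by a greedy error criterion; the theorem is independent of which such $z$ is selected). Define $\alpha\in\mathbb R^{2k}$ by $\alpha_i=-\Omega_{J_{2n}}(z,Te_i)$ for $1\le i\le k$ and $\alpha_{k+i}=\Omega_{J_{2n}}(z,e_i)$ for $1\le i\le k$; this is the coefficient vector for which $\Omega_{J_{2n}}(z+\tilde A_{2k}\alpha,y)=0$ for all $y\in\mathrm{colspan}(\tilde A_{2k})$. Set $\tilde z=z+\tilde A_{2k}\alpha$, $e_{k+1}=\tilde z/\|\tilde z\|_X$, and $\tilde A_{2k+2}=[e_1|\dots|e_{k+1}|Te_1|\dots|Te_{k+1}]$. *)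

theory Defs
  imports Complex_Main "Jordan_Normal_Form.VS_Connect" "Jordan_Normal_Form.Gauss_Jordan_Elimination"
begin

definition sym_pos_def :: "nat \<Rightarrow> real mat \<Rightarrow> bool" where
  "sym_pos_def m A \<longleftrightarrow>
     A \<in> carrier_mat m m \<and> transpose_mat A = A \<and>
     (\<forall>v \<in> carrier_vec m. v \<noteq> 0\<^sub>v m \<longrightarrow> 0 < v \<bullet> (A *\<^sub>v v))"

text \<open>The description below is proper only for symmetric positive definite \<open>X\<close>,
  which is the only case in which it is used.\<close>

definition mat_sqrt :: "real mat \<Rightarrow> real mat" where
  "mat_sqrt X = (THE S. sym_pos_def (dim_row X) S \<and> S * S = X)"

definition mat_inv_sqrt :: "real mat \<Rightarrow> real mat" where
  "mat_inv_sqrt X = the (mat_inverse (mat_sqrt X))"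

definition symp_unit :: "nat \<Rightarrow> real mat" where
  "symp_unit m = four_block_mat (0\<^sub>m m m) (1\<^sub>m m) (- 1\<^sub>m m) (0\<^sub>m m m)"

definition X_norm :: "real mat \<Rightarrow> real vec \<Rightarrow> real" where
  "X_norm X x = sqrt (x \<bullet> (X *\<^sub>v x))"

definition X_normalize :: "real mat \<Rightarrow> real vec \<Rightarrow> real vec" where
  "X_normalize X x = (1 / X_norm X x) \<cdot>\<^sub>v x"

definition J_mat :: "nat \<Rightarrow> real mat \<Rightarrow> real mat" where
  "J_mat n X = mat_sqrt X * symp_unit n * mat_sqrt X"

definition T_mat :: "nat \<Rightarrow> real mat \<Rightarrow> real mat" where
  "T_mat n X = mat_inv_sqrt X * transpose_mat (symp_unit n) * mat_sqrt X"

definition Omega :: "real mat \<Rightarrow> real vec \<Rightarrow> real vec \<Rightarrow> real" where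
  "Omega J x y = x \<bullet> (J *\<^sub>v y)"

definition greedy_mat :: "nat \<Rightarrow> real mat \<Rightarrow> real vec list \<Rightarrow> real mat" where
  "greedy_mat n X es = mat_of_cols (2 * n) (es @ map (\<lambda>e. T_mat n X *\<^sub>v e) es)"

text \<open>Indices are counted from 0: the first \<open>k = length es\<close> entries belong to the columns
  \<open>es ! i\<close> of the matrix above, the last \<open>k\<close> to the columns \<open>T (es ! i)\<close>.\<close>

definition greedy_coeff :: "nat \<Rightarrow> real mat \<Rightarrow> real vec list \<Rightarrow> real vec \<Rightarrow> real vec" where
  "greedy_coeff n X es z = (let k = length es in
     vec (2 * k) (\<lambda>i. if i < k then - Omega (J_mat n X) z (T_mat n X *\<^sub>v (es ! i))
                              else Omega (J_mat n X) z (es ! (i - k))))"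

text \<open>\<open>greedy_vectors n X k es\<close>: the list \<open>es = [e\<^sub>1, \<dots>, e\<^sub>k]\<close> can arise from \<open>k\<close> steps
  of the greedy method. The vector \<open>z\<close> chosen in each step is arbitrary outside the current column
  span, so every finite snapshot set and every error criterion for the selection are covered.\<close>

inductive greedy_vectors :: "nat \<Rightarrow> real mat \<Rightarrow> nat \<Rightarrow> real vec list \<Rightarrow> bool"
  for n :: nat and X :: "real mat" where
  start: "\<lbrakk>z0 \<in> carrier_vec (2 * n); z0 \<noteq> 0\<^sub>v (2 * n)\<rbrakk>
    \<Longrightarrow> greedy_vectors n X 1 [X_normalize X z0]"
| step: "\<lbrakk>greedy_vectors n X k es; z \<in> carrier_vec (2 * n);
      z \<notin> vec_space.col_space (2 * n) (greedy_mat n X es)\<rbrakk>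
    \<Longrightarrow> greedy_vectors n X (Suc k)
          (es @ [X_normalize X (z + greedy_mat n X es *\<^sub>v greedy_coeff n X es z)])"

end

theory Submission
  imports Defs "Jordan_Normal_Form.Char_Poly"
begin

text \<open>
  Write \<open>\<langle>x, y\<rangle> = x \<bullet> X y\<close>, \<open>S = X\<^sup>1\<^sup>/\<^sup>2\<close>, \<open>E\<close> for the standard symplectic unit and
  \<open>J = S E S\<close>, \<open>T = S\<^sup>-\<^sup>1 E\<^sup>T S\<close>. Since \<open>E\<^sup>T = - E\<close> and \<open>E E\<^sup>T = 1\<close>, multiplying out gives
  \<open>X T = - J\<close> and \<open>J T = X\<close> (\<open>J_T_identities\<close>). These two identities express everything symplectic
  in terms of the inner product: \<open>\<Omega>(x, T y) = \<langle>x, y\<rangle>\<close> and \<open>\<Omega>(x, y) = - \<langle>x, T y\<rangle>\<close>; moreover \<open>T\<close> is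
  skew-adjoint and an isometry for \<open>\<langle>\<cdot>, \<cdot>\<rangle>\<close>.

  Consequently the coefficients of the greedy method are \<open>\<alpha> = - A\<^sup>T X z\<close>, where \<open>A\<close> is the current
  basis matrix (\<open>greedy_coeff_eq_projection\<close>): the symplectic Gram-Schmidt step is an ordinary
  Gram-Schmidt step for \<open>\<langle>\<cdot>, \<cdot>\<rangle>\<close>. If \<open>A\<^sup>T X A = 1\<close>, the residual is therefore orthogonal to every
  \<open>e\<^sub>i\<close> and every \<open>T e\<^sub>i\<close>, and it is nonzero because \<open>z\<close> is outside the column span
  (\<open>greedy_residual\<close>). The second new column \<open>T e\<close> needs no work of its own: skewness gives
  \<open>\<langle>e, T e\<rangle> = 0\<close> and \<open>\<langle>e\<^sub>i, T e\<rangle> = - \<langle>T e\<^sub>i, e\<rangle> = 0\<close>, the isometry property gives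
  \<open>\<langle>T e\<^sub>i, T e\<rangle> = \<langle>e\<^sub>i, e\<rangle>\<close>. So the induction only has to carry that the \<open>e\<^sub>i\<close> are orthonormal and
  that \<open>\<langle>e\<^sub>i, T e\<^sub>j\<rangle> = 0\<close> for all \<open>i, j\<close> (\<open>isotropic_orthonormal\<close>).

  The square root \<open>S\<close> is given by a definite description, so all this presupposes that a symmetric
  positive definite matrix has exactly one symmetric positive definite square root. Existence
  is by induction on the dimension: a real symmetric matrix has a real eigenvector, a
  Householder reflection moves it to the first coordinate axis and splits off a one-dimensional
  block. Uniqueness follows by a trace argument: the difference of two roots anticommutes
  with their sum, which is positive definite.
\<close>

section \<open>Symmetric bilinear forms\<close>

lemma mult_unit_vec_eq_col:
  fixes A :: "real mat"
  assumes "A \<in> carrier_mat m n" "j < n"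
  shows "A *\<^sub>v unit_vec n j = col A j"
  using assms by (intro eq_vecI) auto

lemma eq_matI_action:
  fixes A B :: "real mat"
  assumes A: "A \<in> carrier_mat m n" and B: "B \<in> carrier_mat m n"
    and eq: "\<And>x. x \<in> carrier_vec n \<Longrightarrow> A *\<^sub>v x = B *\<^sub>v x"
  shows "A = B"
proof (rule mat_col_eqI)
  fix j assume "j < dim_col B"
  then have j: "j < n" using B by simp
  show "col A j = col B j"
    using eq[of "unit_vec n j"] mult_unit_vec_eq_col[OF A j] mult_unit_vec_eq_col[OF B j] by simp
qed (use A B in auto)

lemma symmetric_form_commute:
  fixes A :: "real mat"
  assumes A: "A \<in> carrier_mat n n" "transpose_mat A = A"
    and xy: "x \<in> carrier_vec n" "y \<in> carrier_vec n"
  shows "x \<bullet> (A *\<^sub>v y) = y \<bullet> (A *\<^sub>v x)"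
proof -
  have "x \<bullet> (A *\<^sub>v y) = (A *\<^sub>v x) \<bullet> y"
    using transpose_vec_mult_scalar[OF A(1) xy(2,1)] A(2) by simp
  also have "\<dots> = y \<bullet> (A *\<^sub>v x)"
    by (rule comm_scalar_prod[of _ n]) (use A xy in auto)
  finally show ?thesis .
qed

lemma self_scalar_prod_pos:
  fixes v :: "real vec"
  assumes "v \<in> carrier_vec n" "v \<noteq> 0\<^sub>v n"
  shows "0 < v \<bullet> v"
  using conjugate_square_greater_0_vec[OF assms(1)] assms(2)
  by (simp add: conjugate_vec_def)

section \<open>Real eigenvectors and Householder reflections\<close>

text \<open>The complexified matrix has an eigenvector \<open>w = a + \<i> b\<close> by the fundamental theorem of
  algebra. Comparing \<open>b \<bullet> A a\<close> with \<open>a \<bullet> A b\<close> shows that the eigenvalue is real, so that \<open>a\<close>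
  and \<open>b\<close> both satisfy the eigenvalue equation; one of them is nonzero.\<close>
lemma symmetric_real_eigenvector:
  fixes A :: "real mat"
  assumes A: "A \<in> carrier_mat n n" "transpose_mat A = A" and n: "0 < n"
  obtains v l where "v \<in> carrier_vec n" "v \<noteq> 0\<^sub>v n" "A *\<^sub>v v = l \<cdot>\<^sub>v v"
proof -
  let ?C = "map_mat complex_of_real A"
  have C: "?C \<in> carrier_mat n n" using A by simp
  obtain as where as: "char_poly ?C = (\<Prod>a\<leftarrow>as. [:- a, 1:])" "length as = n"
    using char_poly_factorized[OF C] by blast
  then obtain mu as' where "as = mu # as'" using n by (cases as) auto
  then have "poly (char_poly ?C) mu = 0" using as by simp
  then obtain w where "eigenvector ?C w mu"
    using eigenvalue_root_char_poly[OF C] unfolding eigenvalue_def by blast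
  then have w: "w \<in> carrier_vec n" "w \<noteq> 0\<^sub>v n" "?C *\<^sub>v w = mu \<cdot>\<^sub>v w"
    using C unfolding eigenvector_def by auto
  define a where "a = map_vec Re w"
  define b where "b = map_vec Im w"
  have ab: "a \<in> carrier_vec n" "b \<in> carrier_vec n" using w by (auto simp: a_def b_def)
  have wi: "(\<Sum>j<n. complex_of_real (A $$ (i,j)) * w $ j) = mu * w $ i" if "i < n" for i
  proof -
    have "(?C *\<^sub>v w) $ i = (\<Sum>j<n. complex_of_real (A $$ (i,j)) * w $ j)"
      using that A w(1) by (auto simp: scalar_prod_def lessThan_atLeast0 intro!: sum.cong)
    then show ?thesis using w that by simp
  qed
  have Aa: "A *\<^sub>v a = Re mu \<cdot>\<^sub>v a - Im mu \<cdot>\<^sub>v b"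
  proof (rule eq_vecI)
    fix i assume "i < dim_vec (Re mu \<cdot>\<^sub>v a - Im mu \<cdot>\<^sub>v b)"
    then have i: "i < n" using ab by simp
    have "(A *\<^sub>v a) $ i = (\<Sum>j<n. A $$ (i,j) * Re (w $ j))"
      using i A w by (auto simp: a_def scalar_prod_def lessThan_atLeast0 intro!: sum.cong)
    also have "\<dots> = Re (mu * w $ i)" by (simp flip: wi[OF i])
    finally show "(A *\<^sub>v a) $ i = (Re mu \<cdot>\<^sub>v a - Im mu \<cdot>\<^sub>v b) $ i"
      using i w by (simp add: a_def b_def)
  qed (use A ab in auto)
  have Ab: "A *\<^sub>v b = Re mu \<cdot>\<^sub>v b + Im mu \<cdot>\<^sub>v a"
  proof (rule eq_vecI)
    fix i assume "i < dim_vec (Re mu \<cdot>\<^sub>v b + Im mu \<cdot>\<^sub>v a)"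
    then have i: "i < n" using ab by simp
    have "(A *\<^sub>v b) $ i = (\<Sum>j<n. A $$ (i,j) * Im (w $ j))"
      using i A w by (auto simp: b_def scalar_prod_def lessThan_atLeast0 intro!: sum.cong)
    also have "\<dots> = Im (mu * w $ i)" by (simp flip: wi[OF i])
    finally show "(A *\<^sub>v b) $ i = (Re mu \<cdot>\<^sub>v b + Im mu \<cdot>\<^sub>v a) $ i"
      using i w by (simp add: a_def b_def)
  qed (use A ab in auto)
  have nz: "a \<noteq> 0\<^sub>v n \<or> b \<noteq> 0\<^sub>v n"
  proof (rule ccontr)
    assume "\<not> ?thesis"
    then have "a $ i = 0 \<and> b $ i = 0" if "i < n" for i using that by simp
    then have "w = 0\<^sub>v n"
      using w(1) by (intro eq_vecI) (auto simp: a_def b_def complex_eq_iff)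
    then show False using w(2) by simp
  qed
  have "b \<bullet> (A *\<^sub>v a) = a \<bullet> (A *\<^sub>v b)"
    by (rule symmetric_form_commute[OF A ab(2,1)])
  then have "Im mu * (a \<bullet> a + b \<bullet> b) = 0"
    unfolding Aa Ab using ab comm_scalar_prod[OF ab]
    by (simp add: scalar_prod_add_distrib[of _ n] scalar_prod_minus_distrib[of _ n] algebra_simps)
  moreover have "0 < a \<bullet> a + b \<bullet> b"
    using nz self_scalar_prod_pos[OF ab(1)] self_scalar_prod_pos[OF ab(2)] ab
    by (cases "a = 0\<^sub>v n"; cases "b = 0\<^sub>v n") auto
  ultimately have im: "Im mu = 0" by simp
  then have "A *\<^sub>v a = Re mu \<cdot>\<^sub>v a" "A *\<^sub>v b = Re mu \<cdot>\<^sub>v b"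
    unfolding Aa Ab using ab by auto
  then show thesis using nz that ab by blast
qed

text \<open>\<open>H\<close> is the reflection in the hyperplane that bisects the first basis vector and \<open>v\<close>.\<close>
lemma householder_reflection:
  fixes v :: "real vec"
  assumes v: "v \<in> carrier_vec n" and v1: "v \<bullet> v = 1" and n: "0 < n"
  obtains H where "H \<in> carrier_mat n n" "transpose_mat H = H" "H * H = 1\<^sub>m n"
    "H *\<^sub>v unit_vec n 0 = v"
proof -
  define u where "u = v - unit_vec n 0"
  \<comment> \<open>If \<open>v\<close> is the first basis vector, then \<open>c = 2 / 0 = 0\<close> and \<open>H\<close> is the identity, as wanted.\<close>
  define c where "c = 2 / (u \<bullet> u)"
  define H where "H = mat n n (\<lambda>(i,j). (if i = j then 1 else 0) - c * u $ i * u $ j)"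
  have u: "u \<in> carrier_vec n" using v by (simp add: u_def)
  have H: "H \<in> carrier_mat n n" by (simp add: H_def)
  have Hx: "H *\<^sub>v x = x - (c * (u \<bullet> x)) \<cdot>\<^sub>v u" if x: "x \<in> carrier_vec n" for x
  proof (rule eq_vecI)
    fix i assume "i < dim_vec (x - (c * (u \<bullet> x)) \<cdot>\<^sub>v u)"
    then have i: "i < n" using u by simp
    have "(H *\<^sub>v x) $ i = (\<Sum>j<n. ((if i = j then 1 else 0) - c * u $ i * u $ j) * x $ j)"
      using i x by (auto simp: H_def scalar_prod_def lessThan_atLeast0 intro!: sum.cong)
    also have "\<dots> = (\<Sum>j<n. (if i = j then x $ j else 0) - c * u $ i * (u $ j * x $ j))"
      by (intro sum.cong) (auto simp: algebra_simps)
    also have "\<dots> = x $ i - c * u $ i * (\<Sum>j<n. u $ j * x $ j)"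
      using i by (simp add: sum_subtractf sum_distrib_left)
    also have "(\<Sum>j<n. u $ j * x $ j) = u \<bullet> x"
      using x by (simp add: scalar_prod_def lessThan_atLeast0)
    finally show "(H *\<^sub>v x) $ i = (x - (c * (u \<bullet> x)) \<cdot>\<^sub>v u) $ i"
      using i x u by simp
  qed (use H u x in auto)
  have cu: "c * (u \<bullet> u) = 2 \<or> u = 0\<^sub>v n"
  proof (cases "u = 0\<^sub>v n")
    case False
    then show ?thesis using self_scalar_prod_pos[OF u] by (simp add: c_def)
  qed simp
  have "H * H = 1\<^sub>m n"
  proof (rule eq_matI_action)
    fix x :: "real vec" assume x: "x \<in> carrier_vec n"
    have "H *\<^sub>v (H *\<^sub>v x) = x"
    proof (cases "u = 0\<^sub>v n")
      case True
      have "H *\<^sub>v y = y" if "y \<in> carrier_vec n" for y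
        using that by (subst Hx) (auto simp: True)
      then show ?thesis using x by simp
    next
      case False
      let ?t = "c * (u \<bullet> x)"
      have uHx: "u \<bullet> (H *\<^sub>v x) = u \<bullet> x - ?t * (u \<bullet> u)"
        unfolding Hx[OF x] using x u by (subst scalar_prod_minus_distrib[of _ n]) auto
      have "c * (u \<bullet> (H *\<^sub>v x)) = ?t - ?t * (c * (u \<bullet> u))"
        by (simp add: uHx algebra_simps)
      also have "\<dots> = - ?t" using cu False by simp
      finally have "H *\<^sub>v (H *\<^sub>v x) = H *\<^sub>v x - (- ?t) \<cdot>\<^sub>v u"
        using H x by (subst Hx[of "H *\<^sub>v x"]) auto
      also have "\<dots> = x" unfolding Hx[OF x] using x u by (intro eq_vecI) auto
      finally show ?thesis .
    qed
    then show "(H * H) *\<^sub>v x = 1\<^sub>m n *\<^sub>v x" using H x by simp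
  qed (use H in auto)
  moreover have "H *\<^sub>v unit_vec n 0 = v"
  proof -
    let ?e = "unit_vec n 0 :: real vec"
    have ue: "u \<bullet> ?e = v $ 0 - 1"
      unfolding u_def using v n by (subst minus_scalar_prod_distrib[of _ n]) auto
    have uv: "u \<bullet> v = 1 - v $ 0"
      unfolding u_def using v n v1 by (subst minus_scalar_prod_distrib[of _ n]) auto
    have "u \<bullet> u = u \<bullet> v - u \<bullet> ?e"
      using v u by (subst (2) u_def, subst scalar_prod_minus_distrib[of _ n]) auto
    then have uu: "u \<bullet> u = - 2 * (u \<bullet> ?e)" unfolding ue uv by simp
    have "c * (u \<bullet> u) = - 2 * (c * (u \<bullet> ?e))" by (simp add: uu)
    then have "c * (u \<bullet> ?e) = -1 \<or> u = 0\<^sub>v n" using cu by auto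
    then have "H *\<^sub>v ?e = ?e + u" using Hx[of ?e] u by auto
    also have "\<dots> = v" using v unfolding u_def by (intro eq_vecI) auto
    finally show ?thesis .
  qed
  moreover have "transpose_mat H = H"
    by (rule eq_matI) (auto simp: H_def)
  ultimately show thesis using that H by blast
qed

section \<open>The symmetric positive definite square root\<close>
lemma sym_pos_defD:
  assumes "sym_pos_def m A"
  shows "A \<in> carrier_mat m m" "transpose_mat A = A"
    "\<And>v. v \<in> carrier_vec m \<Longrightarrow> v \<noteq> 0\<^sub>v m \<Longrightarrow> 0 < v \<bullet> (A *\<^sub>v v)"
  using assms by (auto simp: sym_pos_def_def)

lemma sym_pos_def_congruence:
  assumes A: "sym_pos_def m A"
    and H: "H \<in> carrier_mat m m" "transpose_mat H = H" "H * H = 1\<^sub>m m"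
  shows "sym_pos_def m (H * A * H)"
  unfolding sym_pos_def_def
proof (intro conjI ballI impI)
  note A = sym_pos_defD[OF A]
  show "H * A * H \<in> carrier_mat m m" using A H by simp
  show "transpose_mat (H * A * H) = H * A * H"
    using A H by (simp add: transpose_mult[of _ m m _ m])
  fix v :: "real vec" assume v: "v \<in> carrier_vec m" "v \<noteq> 0\<^sub>v m"
  have Hv: "H *\<^sub>v v \<in> carrier_vec m" using H v by simp
  have "H *\<^sub>v (H *\<^sub>v v) = v" using H v by (simp flip: assoc_mult_mat_vec)
  moreover have "H *\<^sub>v 0\<^sub>v m = 0\<^sub>v m" using H by (intro eq_vecI) auto
  ultimately have "H *\<^sub>v v \<noteq> 0\<^sub>v m" using v by auto
  then have "0 < (H *\<^sub>v v) \<bullet> (A *\<^sub>v (H *\<^sub>v v))" using A(3) Hv by simp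
  also have "\<dots> = v \<bullet> (H *\<^sub>v (A *\<^sub>v (H *\<^sub>v v)))"
    using transpose_vec_mult_scalar[OF H(1), of "A *\<^sub>v (H *\<^sub>v v)" v] A H v by simp
  also have "H *\<^sub>v (A *\<^sub>v (H *\<^sub>v v)) = H * A * H *\<^sub>v v"
    using A(1) H(1) v by (simp add: assoc_mult_mat_vec[of _ m m _ m] del: assoc_mult_mat)
  finally show "0 < v \<bullet> (H * A * H *\<^sub>v v)" .
qed

lemma sym_pos_def_four_block_iff:
  assumes A: "A \<in> carrier_mat m m" and B: "B \<in> carrier_mat n n"
  shows "sym_pos_def (m + n) (four_block_mat A (0\<^sub>m m n) (0\<^sub>m n m) B) \<longleftrightarrow>
    sym_pos_def m A \<and> sym_pos_def n B" (is "sym_pos_def _ ?M \<longleftrightarrow> _")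
proof
  note form = mult_mat_vec_split[OF A B]
  assume "sym_pos_def (m + n) ?M"
  note M = sym_pos_defD[OF this]
  have T: "four_block_mat (transpose_mat A) (0\<^sub>m m n) (0\<^sub>m n m) (transpose_mat B) = ?M"
    using M(2) A B by (simp add: transpose_four_block_mat[OF A _ _ B])
  have "transpose_mat A = A"
  proof (rule eq_matI)
    fix i j assume "i < dim_row A" "j < dim_col A"
    then show "transpose_mat A $$ (i,j) = A $$ (i,j)"
      using arg_cong[OF T, of "\<lambda>N. N $$ (i,j)"] A B by simp
  qed (use A in auto)
  moreover have "transpose_mat B = B"
  proof (rule eq_matI)
    fix i j assume "i < dim_row B" "j < dim_col B"
    then show "transpose_mat B $$ (i,j) = B $$ (i,j)"
      using arg_cong[OF T, of "\<lambda>N. N $$ (m+i,m+j)"] A B by simp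
  qed (use B in auto)
  moreover have "0 < v \<bullet> (A *\<^sub>v v)" if v: "v \<in> carrier_vec m" "v \<noteq> 0\<^sub>v m" for v
  proof -
    let ?w = "v @\<^sub>v 0\<^sub>v n"
    have "?w \<noteq> 0\<^sub>v m @\<^sub>v 0\<^sub>v n" using v by (subst append_vec_eq[OF v(1)]) auto
    moreover have "0\<^sub>v m @\<^sub>v 0\<^sub>v n = (0\<^sub>v (m+n) :: real vec)" by (intro eq_vecI) auto
    ultimately have "0 < ?w \<bullet> (?M *\<^sub>v ?w)" using M(3)[of ?w] v by simp
    then show ?thesis using v A B by (simp add: form scalar_prod_append[of _ m _ n])
  qed
  moreover have "0 < v \<bullet> (B *\<^sub>v v)" if v: "v \<in> carrier_vec n" "v \<noteq> 0\<^sub>v n" for v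
  proof -
    let ?w = "0\<^sub>v m @\<^sub>v v"
    have "?w \<noteq> 0\<^sub>v m @\<^sub>v 0\<^sub>v n" using v by (subst append_vec_eq[of _ m]) auto
    moreover have "0\<^sub>v m @\<^sub>v 0\<^sub>v n = (0\<^sub>v (m+n) :: real vec)" by (intro eq_vecI) auto
    ultimately have "0 < ?w \<bullet> (?M *\<^sub>v ?w)" using M(3)[of ?w] v by simp
    then show ?thesis using v A B by (simp add: form scalar_prod_append[of _ m _ n])
  qed
  ultimately show "sym_pos_def m A \<and> sym_pos_def n B"
    using A B by (simp add: sym_pos_def_def)
next
  note form = mult_mat_vec_split[OF A B]
  assume "sym_pos_def m A \<and> sym_pos_def n B"
  then have SA: "sym_pos_def m A" and SB: "sym_pos_def n B" by auto
  note A' = sym_pos_defD[OF SA] and B' = sym_pos_defD[OF SB]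
  show "sym_pos_def (m + n) ?M" unfolding sym_pos_def_def
  proof (intro conjI ballI impI)
    show "?M \<in> carrier_mat (m + n) (m + n)" using A B by simp
    show "transpose_mat ?M = ?M"
      using A' B' by (simp add: transpose_four_block_mat[OF A _ _ B])
    fix v :: "real vec" assume v: "v \<in> carrier_vec (m + n)" "v \<noteq> 0\<^sub>v (m + n)"
    define x where "x = vec_first v m"
    define y where "y = vec_last v n"
    have xy: "x \<in> carrier_vec m" "y \<in> carrier_vec n" by (auto simp: x_def y_def)
    have vxy: "v = x @\<^sub>v y" using v by (simp add: x_def y_def)
    have "v \<bullet> (?M *\<^sub>v v) = x \<bullet> (A *\<^sub>v x) + y \<bullet> (B *\<^sub>v y)"
      unfolding vxy using xy A B by (simp add: form scalar_prod_append[of _ m _ n])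
    moreover have "x \<noteq> 0\<^sub>v m \<or> y \<noteq> 0\<^sub>v n"
    proof (rule ccontr)
      assume "\<not> ?thesis"
      then have "v = 0\<^sub>v (m + n)" unfolding vxy by (intro eq_vecI) auto
      then show False using v by simp
    qed
    ultimately show "0 < v \<bullet> (?M *\<^sub>v v)"
      using A'(3)[OF xy(1)] B'(3)[OF xy(2)] xy A B
      by (cases "x = 0\<^sub>v m"; cases "y = 0\<^sub>v n") auto
  qed
qed

lemma sym_pos_def_1: "sym_pos_def 1 (mat 1 1 (\<lambda>_. c)) \<longleftrightarrow> 0 < c"
proof -
  have form: "v \<bullet> (mat 1 1 (\<lambda>_. c) *\<^sub>v v) = c * (v $ 0)\<^sup>2" if "v \<in> carrier_vec 1" for v
    using that by (simp add: scalar_prod_def power2_eq_square)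
  show ?thesis
  proof
    assume "sym_pos_def 1 (mat 1 1 (\<lambda>_. c))"
    moreover have "unit_vec 1 0 \<noteq> (0\<^sub>v 1 :: real vec)" by simp
    ultimately have "0 < unit_vec 1 0 \<bullet> (mat 1 1 (\<lambda>_. c) *\<^sub>v unit_vec 1 0)"
      by (intro sym_pos_defD(3)) auto
    then show "0 < c" by (simp add: form del: One_nat_def)
  next
    assume c: "0 < c"
    have "v $ 0 \<noteq> 0" if "v \<in> carrier_vec 1" "v \<noteq> 0\<^sub>v 1" for v :: "real vec"
      using that by (metis carrier_vecD eq_vecI index_zero_vec less_one)
    then show "sym_pos_def 1 (mat 1 1 (\<lambda>_. c))"
      unfolding sym_pos_def_def using c by (auto simp: form simp del: One_nat_def)
  qed
qed

text \<open>In coordinates whose first axis is an eigenvector, symmetry makes the first row vanish off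
  the diagonal together with the first column; the remaining block is positive definite of
  smaller size, and the root is assembled block by block.\<close>
lemma sym_pos_def_sqrt_exists:
  assumes "sym_pos_def m A"
  shows "\<exists>S. sym_pos_def m S \<and> S * S = A"
  using assms
proof (induction m arbitrary: A)
  case 0
  then have "A * A = A" by (intro eq_matI) (auto simp: sym_pos_def_def)
  then show ?case using 0 by blast
next
  case (Suc m)
  note A = sym_pos_defD[OF Suc.prems]
  obtain v l where v: "v \<in> carrier_vec (Suc m)" "v \<noteq> 0\<^sub>v (Suc m)" "A *\<^sub>v v = l \<cdot>\<^sub>v v"
    using symmetric_real_eigenvector[OF A(1,2)] by blast
  have vv: "0 < v \<bullet> v" using self_scalar_prod_pos v by blast
  define u where "u = (1 / sqrt (v \<bullet> v)) \<cdot>\<^sub>v v"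
  have u: "u \<in> carrier_vec (Suc m)" using v by (simp add: u_def)
  have u1: "u \<bullet> u = 1" using v vv by (simp add: u_def)
  have Au: "A *\<^sub>v u = l \<cdot>\<^sub>v u"
    using v A by (simp add: u_def mult_mat_vec smult_smult_assoc mult.commute)
  obtain H where H: "H \<in> carrier_mat (Suc m) (Suc m)" "transpose_mat H = H"
    "H * H = 1\<^sub>m (Suc m)" "H *\<^sub>v unit_vec (Suc m) 0 = u"
    using householder_reflection[OF u u1] by blast
  have Hu: "H *\<^sub>v u = unit_vec (Suc m) 0"
    using H unfolding H(4)[symmetric] by (simp flip: assoc_mult_mat_vec)
  define M where "M = H * A * H"
  have M: "sym_pos_def (Suc m) M"
    unfolding M_def by (rule sym_pos_def_congruence[OF Suc.prems H(1-3)])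
  note M' = sym_pos_defD[OF M]
  define B where "B = mat m m (\<lambda>(i,j). M $$ (Suc i, Suc j))"
  have B: "B \<in> carrier_mat m m" by (simp add: B_def)
  let ?L = "\<lambda>c. mat 1 1 (\<lambda>_. c) :: real mat"
  let ?blk = "\<lambda>c N. four_block_mat (?L c) (0\<^sub>m 1 m) (0\<^sub>m m 1) N"
  have "M *\<^sub>v unit_vec (Suc m) 0 = l \<cdot>\<^sub>v unit_vec (Suc m) 0"
  proof -
    have "M *\<^sub>v unit_vec (Suc m) 0 = H *\<^sub>v (A *\<^sub>v (H *\<^sub>v unit_vec (Suc m) 0))"
      unfolding M_def using A(1) H(1) by (simp add: assoc_mult_mat_vec[of _ "Suc m" "Suc m" _ "Suc m"] del: assoc_mult_mat)
    then show ?thesis using u by (simp add: H(4) Au mult_mat_vec[OF H(1)] Hu)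
  qed
  then have "col M 0 = l \<cdot>\<^sub>v unit_vec (Suc m) 0"
    using mult_unit_vec_eq_col[OF M'(1)] by simp
  then have M0: "M $$ (i, 0) = (if i = 0 then l else 0)" if "i < Suc m" for i
  proof -
    have "M $$ (i, 0) = col M 0 $ i" using that M'(1) by simp
    then show ?thesis using that \<open>col M 0 = _\<close> by simp
  qed
  have "M $$ (0, i) = M $$ (i, 0)" if "i < Suc m" for i
    using that M'(1) arg_cong[OF M'(2), of "\<lambda>N. N $$ (i,0)"] by simp
  with M0 have M0': "M $$ (0, i) = (if i = 0 then l else 0)" if "i < Suc m" for i
    using that by simp
  have blk: "M = ?blk l B"
    using M'(1) by (intro eq_matI) (auto simp: M0 M0' B_def)
  have L: "?L c \<in> carrier_mat 1 1" for c by simp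
  have "0 < l" "sym_pos_def m B"
    using M sym_pos_def_four_block_iff[OF L B] unfolding blk
    by (auto simp: sym_pos_def_1[simplified])
  then obtain S where S: "sym_pos_def m S" "S * S = B" using Suc.IH by blast
  note S' = sym_pos_defD[OF S(1)]
  define R where "R = ?blk (sqrt l) S"
  have R: "sym_pos_def (Suc m) R"
    using sym_pos_def_four_block_iff[OF L S'(1), of "sqrt l"] S(1) \<open>0 < l\<close>
    by (simp add: R_def sym_pos_def_1[simplified])
  note R' = sym_pos_defD[OF R]
  have "?L (sqrt l) * ?L (sqrt l) = ?L l"
    using \<open>0 < l\<close> by (intro eq_matI) (auto simp: scalar_prod_def)
  then have RR: "R * R = M"
    unfolding R_def blk using S S'(1)
    by (subst mult_four_block_mat[OF L _ _ S'(1) L _ _ S'(1)]) auto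
  note assoc = assoc_mult_mat[of _ "Suc m" "Suc m" _ "Suc m" _ "Suc m"]
  \<comment> \<open>Undo the change of coordinates: \<open>H\<close> is its own inverse.\<close>
  have HH: "H * (H * N) = N" if "N \<in> carrier_mat (Suc m) (Suc m)" for N
    using that H(1,3) assoc[of H H N] by simp
  have "(H * R * H) * (H * R * H) = H * (R * R) * H"
    using H(1) R'(1) by (simp add: assoc HH)
  also have "\<dots> = A" unfolding RR M_def using H(1,3) A(1) by (simp add: assoc HH)
  finally show ?case using sym_pos_def_congruence[OF R H(1-3)] by blast
qed


lemma trace_mult_commute:
  fixes A B :: "real mat"
  assumes A: "A \<in> carrier_mat m m" and B: "B \<in> carrier_mat m m"
  shows "(\<Sum>i<m. (A * B) $$ (i,i)) = (\<Sum>i<m. (B * A) $$ (i,i))"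
proof -
  have tr: "(\<Sum>i<m. (P * Q) $$ (i,i)) = (\<Sum>i<m. \<Sum>j<m. P $$ (i,j) * Q $$ (j,i))"
    if "P \<in> carrier_mat m m" "Q \<in> carrier_mat m m" for P Q :: "real mat"
    using that by (intro sum.cong) (auto simp: scalar_prod_def lessThan_atLeast0)
  show ?thesis
    unfolding tr[OF A B] tr[OF B A] by (subst sum.swap) (simp add: mult.commute)
qed

text \<open>Cyclicity of the trace and \<open>D K = - K D\<close> give \<open>tr (D K D) = tr (K D D) = - tr (D K D)\<close>,
  hence \<open>tr (D K D) = 0\<close>. But this trace is the sum of \<open>d \<bullet> K d\<close> over the columns \<open>d\<close> of \<open>D\<close>, so
  every column vanishes.\<close>
lemma anticommuting_with_sym_pos_def_imp_zero:
  assumes K: "sym_pos_def m K"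
    and D: "D \<in> carrier_mat m m" "transpose_mat D = D"
    and anti: "D * K = - (K * D)"
  shows "D = 0\<^sub>m m m"
proof -
  note K' = sym_pos_defD[OF K]
  have DKD: "(D * (K * D)) $$ (i,i) = col D i \<bullet> (K *\<^sub>v col D i)" if "i < m" for i
  proof -
    have "(D * (K * D)) $$ (i,i) = row D i \<bullet> col (K * D) i" using that D K' by simp
    also have "row D i = col D i" using D that by (metis carrier_matD(2) row_transpose)
    also have "col (K * D) i = K *\<^sub>v col D i" by (rule col_mult2[OF K'(1) D(1) that])
    finally show ?thesis .
  qed
  have "(\<Sum>i<m. (D * (K * D)) $$ (i,i)) = (\<Sum>i<m. (K * D * D) $$ (i,i))"
    using D K' by (intro trace_mult_commute) auto
  also have "K * D * D = - (D * (K * D))"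
  proof -
    have "K * D = - (D * K)" using anti K' D by simp
    then have "K * D * D = - (D * K) * D" by simp
    also have "\<dots> = - (D * (K * D))"
      using K' D by (simp add: assoc_mult_mat[of _ m m _ m])
    finally show ?thesis .
  qed
  also have "(\<Sum>i<m. (- (D * (K * D))) $$ (i,i)) = - (\<Sum>i<m. (D * (K * D)) $$ (i,i))"
    using K' D by (simp add: sum_negf)
  finally have "(\<Sum>i<m. col D i \<bullet> (K *\<^sub>v col D i)) = 0"
    by (simp add: DKD)
  moreover have nonneg: "0 \<le> x \<bullet> (K *\<^sub>v x)" if "x \<in> carrier_vec m" for x
    using K'(1) K'(3)[OF that] that by (cases "x = 0\<^sub>v m") auto
  ultimately have "col D i \<bullet> (K *\<^sub>v col D i) = 0" if "i < m" for i
    using that D by (subst (asm) sum_nonneg_eq_0_iff) auto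
  then have "col D i = 0\<^sub>v m" if "i < m" for i
    using that D K'(3)[of "col D i"] by (metis col_dim carrier_matD(1) less_irrefl)
  then show ?thesis using D by (intro mat_col_eqI) auto
qed

text \<open>With \<open>S\<^sup>2 = R\<^sup>2\<close> one has \<open>(S - R) (S + R) = S R - R S = - (S + R) (S - R)\<close>.\<close>
lemma sym_pos_def_sqrt_unique:
  assumes S: "sym_pos_def m S" and R: "sym_pos_def m R" and eq: "S * S = R * R"
  shows "S = R"
proof -
  note S' = sym_pos_defD[OF S] and R' = sym_pos_defD[OF R]
  have c: "S + R \<in> carrier_mat m m" "S - R \<in> carrier_mat m m"
    using S' R' by auto
  have K: "sym_pos_def m (S + R)"
    unfolding sym_pos_def_def
    using S' R' c
    by (auto simp: transpose_add[of _ m m] add_mult_distrib_mat_vec[of _ m m]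
        scalar_prod_add_distrib[of _ m] intro: add_pos_pos)
  have "(S - R) * (S + R) = (S * S - R * S) + (S * R - R * R)"
    using S'(1) R'(1) c by (simp add: mult_add_distrib_mat[of _ m m] minus_mult_distrib_mat[of _ m m])
  moreover have "(S + R) * (S - R) = (S * S + R * S) - (S * R + R * R)"
    using S'(1) R'(1) c by (simp add: mult_minus_distrib_mat[of _ m m] add_mult_distrib_mat[of _ m m])
  ultimately have "(S - R) * (S + R) = - ((S + R) * (S - R))"
    using S'(1) R'(1) unfolding eq by (intro eq_matI) auto
  then have "S - R = 0\<^sub>m m m"
    using S' R' c by (intro anticommuting_with_sym_pos_def_imp_zero[OF K]) (auto simp: transpose_minus[of _ m m])
  show ?thesis
  proof (rule eq_matI)
    fix i j assume "i < dim_row R" "j < dim_col R"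
    then show "S $$ (i,j) = R $$ (i,j)"
      using arg_cong[OF \<open>S - R = 0\<^sub>m m m\<close>, of "\<lambda>N. N $$ (i,j)"] S'(1) R'(1) by simp
  qed (use S' R' in auto)
qed

lemma mat_sqrt:
  assumes X: "sym_pos_def m X"
  shows "sym_pos_def m (mat_sqrt X)" "mat_sqrt X * mat_sqrt X = X"
proof -
  have dim: "dim_row X = m" using sym_pos_defD(1)[OF X] by simp
  obtain S where S: "sym_pos_def m S \<and> S * S = X"
    using sym_pos_def_sqrt_exists[OF X] by blast
  have "sym_pos_def m (mat_sqrt X) \<and> mat_sqrt X * mat_sqrt X = X"
    unfolding mat_sqrt_def dim
    by (rule theI[where a = S]) (use S sym_pos_def_sqrt_unique[of m _ S] in auto)
  then show "sym_pos_def m (mat_sqrt X)" "mat_sqrt X * mat_sqrt X = X" by auto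
qed

lemma mat_inv_sqrt:
  assumes X: "sym_pos_def m X"
  shows "mat_inv_sqrt X \<in> carrier_mat m m" "mat_sqrt X * mat_inv_sqrt X = 1\<^sub>m m"
proof -
  note S = sym_pos_defD[OF mat_sqrt(1)[OF X]]
  have "v = 0\<^sub>v m" if "v \<in> carrier_vec m" "mat_sqrt X *\<^sub>v v = 0\<^sub>v m" for v
    using S(3)[OF that(1)] that by auto
  then have "det (mat_sqrt X) \<noteq> 0" using det_0_iff_vec_prod_zero[OF S(1)] by blast
  then have "mat_sqrt X \<in> Units (ring_mat TYPE(real) m ())" by (rule det_non_zero_imp_unit[OF S(1)])
  then obtain B where "mat_inverse (mat_sqrt X) = Some B"
    using mat_inverse(1)[OF S(1), where b = "()"] by (cases "mat_inverse (mat_sqrt X)") auto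
  then show "mat_inv_sqrt X \<in> carrier_mat m m" "mat_sqrt X * mat_inv_sqrt X = 1\<^sub>m m"
    using mat_inverse(2)[OF S(1)] by (auto simp: mat_inv_sqrt_def)
qed

section \<open>The symplectic form in terms of the inner product\<close>
lemma symp_unit:
  shows "symp_unit n \<in> carrier_mat (2 * n) (2 * n)"
    "transpose_mat (symp_unit n) = - symp_unit n"
    "symp_unit n * transpose_mat (symp_unit n) = 1\<^sub>m (2 * n)"
proof -
  show c: "symp_unit n \<in> carrier_mat (2 * n) (2 * n)"
    by (auto simp: symp_unit_def)
  show t: "transpose_mat (symp_unit n) = - symp_unit n"
    by (rule eq_matI) (auto simp: symp_unit_def)
  have "symp_unit n * symp_unit n = four_block_mat (- 1\<^sub>m n) (0\<^sub>m n n) (0\<^sub>m n n) (- 1\<^sub>m n)"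
    unfolding symp_unit_def by (subst mult_four_block_mat[of _ n n _ n _ n _ _ n _ n]) auto
  also have "\<dots> = - 1\<^sub>m (2 * n)" by (rule eq_matI) auto
  finally show "symp_unit n * transpose_mat (symp_unit n) = 1\<^sub>m (2 * n)"
    unfolding t using c by simp
qed

text \<open>These identities are all that is used about \<open>J\<close> and \<open>T\<close> from here on; the square root
  does not occur again.\<close>
lemma J_T_identities:
  assumes X: "sym_pos_def (2 * n) X"
  shows "J_mat n X \<in> carrier_mat (2 * n) (2 * n)" "T_mat n X \<in> carrier_mat (2 * n) (2 * n)"
    "transpose_mat (J_mat n X) = - J_mat n X"
    "X * T_mat n X = - J_mat n X" "J_mat n X * T_mat n X = X"
proof -
  define S where "S = mat_sqrt X"
  define R where "R = mat_inv_sqrt X"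
  define E where "E = symp_unit n"
  define N where "N = 2 * n"
  note S = sym_pos_defD(1,2)[OF mat_sqrt(1)[OF X], folded S_def N_def] mat_sqrt(2)[OF X, folded S_def]
  note R = mat_inv_sqrt[OF X, folded S_def R_def N_def]
  note E = symp_unit[of n, folded E_def N_def]
  have J: "J_mat n X = S * E * S" by (simp add: J_mat_def S_def E_def)
  have T: "T_mat n X = R * transpose_mat E * S" by (simp add: T_mat_def S_def E_def R_def)
  note assoc = assoc_mult_mat[of _ N N _ N _ N]
  have SRM: "S * (R * M) = M" if "M \<in> carrier_mat N N" for M
    using R S(1) that assoc_mult_mat[of S N N R N M N] by simp
  have EEM: "E * (transpose_mat E * M) = M" if "M \<in> carrier_mat N N" for M
    using E(1,3) that assoc_mult_mat[of E N N "transpose_mat E" N M N] by simp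
  show "J_mat n X \<in> carrier_mat (2 * n) (2 * n)" "T_mat n X \<in> carrier_mat (2 * n) (2 * n)"
    using S(1) R(1) E(1) by (auto simp: J T simp flip: N_def)
  show "transpose_mat (J_mat n X) = - J_mat n X"
    using S(1,2) E(1,2) by (simp add: J assoc transpose_mult[of _ N N _ N])
  have "X * T_mat n X = S * S * (R * transpose_mat E * S)" by (simp add: T S(3))
  also have "\<dots> = S * (S * (R * (transpose_mat E * S)))"
    using S(1) R(1) E(1) by (simp add: assoc)
  also have "\<dots> = S * (- E * S)" using S(1) E(1) by (simp add: SRM E(2))
  also have "\<dots> = - J_mat n X" using S(1) E(1) by (simp add: J assoc)
  finally show "X * T_mat n X = - J_mat n X" .
  have "J_mat n X * T_mat n X = S * (E * (S * (R * (transpose_mat E * S))))"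
    using S(1) R(1) E(1) unfolding T J by (simp add: assoc)
  also have "\<dots> = S * S" using S(1) E(1) by (simp add: SRM EEM)
  finally show "J_mat n X * T_mat n X = X" unfolding S(3) .
qed

context
  fixes n :: nat and X :: "real mat"
  assumes X: "sym_pos_def (2 * n) X"
begin

private lemmas X' = sym_pos_defD[OF X]
private lemmas JT = J_T_identities[OF X]

lemma T_mult_carrier: "y \<in> carrier_vec (2 * n) \<Longrightarrow> T_mat n X *\<^sub>v y \<in> carrier_vec (2 * n)"
  using JT(2) by simp

lemma X_form_T_right:
  assumes "x \<in> carrier_vec (2 * n)" "y \<in> carrier_vec (2 * n)"
  shows "x \<bullet> (X *\<^sub>v (T_mat n X *\<^sub>v y)) = - Omega (J_mat n X) x y"
proof -
  have "X *\<^sub>v (T_mat n X *\<^sub>v y) = (X * T_mat n X) *\<^sub>v y"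
    using X'(1) JT(2) assms by simp
  then show ?thesis using JT(1) assms by (simp add: JT(4) Omega_def)
qed

lemma Omega_T_right:
  assumes "x \<in> carrier_vec (2 * n)" "y \<in> carrier_vec (2 * n)"
  shows "Omega (J_mat n X) x (T_mat n X *\<^sub>v y) = x \<bullet> (X *\<^sub>v y)"
proof -
  have "J_mat n X *\<^sub>v (T_mat n X *\<^sub>v y) = (J_mat n X * T_mat n X) *\<^sub>v y"
    using JT(1,2) assms by simp
  then show ?thesis by (simp add: JT(5) Omega_def)
qed

lemma Omega_skew:
  assumes x: "x \<in> carrier_vec (2 * n)" and y: "y \<in> carrier_vec (2 * n)"
  shows "Omega (J_mat n X) x y = - Omega (J_mat n X) y x"
proof -
  have "Omega (J_mat n X) x y = (transpose_mat (J_mat n X) *\<^sub>v x) \<bullet> y"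
    unfolding Omega_def by (rule transpose_vec_mult_scalar[OF JT(1) y x, symmetric])
  also have "\<dots> = - ((J_mat n X *\<^sub>v x) \<bullet> y)" using x y JT(1) by (simp add: JT(3))
  also have "(J_mat n X *\<^sub>v x) \<bullet> y = Omega (J_mat n X) y x"
    unfolding Omega_def by (rule comm_scalar_prod[of _ "2 * n"]) (use JT(1) x y in auto)
  finally show ?thesis .
qed

lemma X_form_T_skew:
  assumes "x \<in> carrier_vec (2 * n)" "y \<in> carrier_vec (2 * n)"
  shows "x \<bullet> (X *\<^sub>v (T_mat n X *\<^sub>v y)) = - (y \<bullet> (X *\<^sub>v (T_mat n X *\<^sub>v x)))"
  using Omega_skew[OF assms] assms by (simp add: X_form_T_right)

lemma X_form_T_isometry:
  assumes "x \<in> carrier_vec (2 * n)" "y \<in> carrier_vec (2 * n)"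
  shows "(T_mat n X *\<^sub>v x) \<bullet> (X *\<^sub>v (T_mat n X *\<^sub>v y)) = x \<bullet> (X *\<^sub>v y)"
  using assms symmetric_form_commute[OF X'(1,2) assms(2,1)] Omega_skew[of "T_mat n X *\<^sub>v x" y]
  by (simp add: T_mult_carrier X_form_T_right Omega_T_right)

end

section \<open>The greedy basis\<close>

text \<open>The property is stated for the vectors \<open>e\<^sub>i\<close> alone. By \<open>\<Omega>(x, y) = - \<langle>x, T y\<rangle>\<close> the second
  condition says that \<open>\<Omega>\<close> vanishes on their span.\<close>
definition isotropic_orthonormal :: "nat \<Rightarrow> real mat \<Rightarrow> real vec list \<Rightarrow> bool" where
  "isotropic_orthonormal n X es \<longleftrightarrow> set es \<subseteq> carrier_vec (2 * n) \<and>
     (\<forall>i < length es. \<forall>j < length es.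
        es ! i \<bullet> (X *\<^sub>v es ! j) = (if i = j then 1 else 0) \<and>
        es ! i \<bullet> (X *\<^sub>v (T_mat n X *\<^sub>v es ! j)) = 0)"


lemma greedy_mat_carrier: "greedy_mat n X es \<in> carrier_mat (2 * n) (2 * length es)"
  using mat_of_cols_carrier(1)[of "2 * n" "es @ map (\<lambda>e. T_mat n X *\<^sub>v e) es"]
  by (simp add: greedy_mat_def mult_2)

lemma col_greedy_mat:
  assumes X: "sym_pos_def (2 * n) X" and es: "set es \<subseteq> carrier_vec (2 * n)"
    and i: "i < 2 * length es"
  shows "col (greedy_mat n X es) i =
    (if i < length es then es ! i else T_mat n X *\<^sub>v (es ! (i - length es)))"
proof -
  have "es ! j \<in> carrier_vec (2 * n)" if "j < length es" for j using es that by auto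
  then show ?thesis
    using i T_mult_carrier[OF X] unfolding greedy_mat_def
    by (subst col_mat_of_cols) (auto simp: nth_append)
qed

text \<open>The blocks of the Gram matrix that involve \<open>T e\<^sub>i\<close> reduce to the two conditions on the \<open>e\<^sub>i\<close>:
  the mixed block by symmetry of the inner product, the lower right one because \<open>T\<close> is an isometry.\<close>
lemma isotropic_orthonormal_imp_greedy_mat_orthonormal:
  assumes X: "sym_pos_def (2 * n) X" and es: "isotropic_orthonormal n X es"
  shows "transpose_mat (greedy_mat n X es) * X * greedy_mat n X es = 1\<^sub>m (2 * length es)"
    (is "transpose_mat ?G * X * ?G = _")
proof (rule eq_matI)
  let ?k = "length es"
  have c: "set es \<subseteq> carrier_vec (2 * n)"
    and e: "\<And>i. i < ?k \<Longrightarrow> es ! i \<in> carrier_vec (2 * n)"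
    and o: "\<And>i j. i < ?k \<Longrightarrow> j < ?k \<Longrightarrow> es ! i \<bullet> (X *\<^sub>v es ! j) = (if i = j then 1 else 0)"
    and s: "\<And>i j. i < ?k \<Longrightarrow> j < ?k \<Longrightarrow> es ! i \<bullet> (X *\<^sub>v (T_mat n X *\<^sub>v es ! j)) = 0"
    using es by (auto simp: isotropic_orthonormal_def)
  have s': "(T_mat n X *\<^sub>v es ! i) \<bullet> (X *\<^sub>v es ! j) = 0" if "i < ?k" "j < ?k" for i j
    using symmetric_form_commute[OF sym_pos_defD(1,2)[OF X], of "T_mat n X *\<^sub>v es ! i" "es ! j"]
      s[OF that(2,1)] e that T_mult_carrier[OF X] by simp
  note G = greedy_mat_carrier[of n X es]
  fix i j assume "i < dim_row (1\<^sub>m (2 * ?k) :: real mat)" "j < dim_col (1\<^sub>m (2 * ?k) :: real mat)"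
  then have i: "i < 2 * ?k" and j: "j < 2 * ?k" by auto
  have "(transpose_mat ?G * X * ?G) $$ (i,j) = (transpose_mat ?G * (X * ?G)) $$ (i,j)"
    using G sym_pos_defD(1)[OF X] by simp
  also have "\<dots> = col ?G i \<bullet> (X *\<^sub>v col ?G j)"
    unfolding col_mult2[OF sym_pos_defD(1)[OF X] G j, symmetric]
    using i j G sym_pos_defD(1)[OF X] by simp
  also have "\<dots> = (if i = j then 1 else 0)"
    unfolding col_greedy_mat[OF X c i] col_greedy_mat[OF X c j]
    using i j by (auto simp: o s s' X_form_T_isometry[OF X] e)
  finally show "(transpose_mat ?G * X * ?G) $$ (i,j) = 1\<^sub>m (2 * ?k) $$ (i,j)"
    using i j by simp
qed (use greedy_mat_carrier[of n X es] in auto)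

text \<open>The reason why the symplectic orthogonalization is an orthogonal projection: the form \<open>\<Omega>\<close>
  exchanges the roles of \<open>e\<^sub>i\<close> and \<open>T e\<^sub>i\<close>, and the coefficients of the greedy method are arranged
  so that the column \<open>e\<^sub>i\<close> receives \<open>- \<Omega>(z, T e\<^sub>i) = - \<langle>e\<^sub>i, z\<rangle>\<close> and the column \<open>T e\<^sub>i\<close> receives
  \<open>\<Omega>(z, e\<^sub>i) = - \<langle>T e\<^sub>i, z\<rangle>\<close>.\<close>
lemma greedy_coeff_eq_projection:
  assumes X: "sym_pos_def (2 * n) X" and es: "set es \<subseteq> carrier_vec (2 * n)"
    and z: "z \<in> carrier_vec (2 * n)"
  shows "greedy_coeff n X es z = - (transpose_mat (greedy_mat n X es) *\<^sub>v (X *\<^sub>v z))"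
proof (rule eq_vecI)
  let ?k = "length es"
  note G = greedy_mat_carrier[of n X es]
  note X' = sym_pos_defD[OF X]
  fix i assume "i < dim_vec (- (transpose_mat (greedy_mat n X es) *\<^sub>v (X *\<^sub>v z)))"
  then have i: "i < 2 * ?k" using G by simp
  let ?e = "es ! (if i < ?k then i else i - ?k)"
  have e: "?e \<in> carrier_vec (2 * n)" using es i by auto
  have "(- (transpose_mat (greedy_mat n X es) *\<^sub>v (X *\<^sub>v z))) $ i
      = - (col (greedy_mat n X es) i \<bullet> (X *\<^sub>v z))"
    using i G by simp
  also have "\<dots> = greedy_coeff n X es z $ i"
    using i e symmetric_form_commute[OF X'(1,2) z e] Omega_T_right[OF X z e]
      X_form_T_right[OF X z e]
      symmetric_form_commute[OF X'(1,2) z T_mult_carrier[OF X e]]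
    unfolding col_greedy_mat[OF X es i] by (auto simp: greedy_coeff_def Let_def split: if_splits)
  finally show "greedy_coeff n X es z $ i
      = (- (transpose_mat (greedy_mat n X es) *\<^sub>v (X *\<^sub>v z))) $ i" by simp
qed (use greedy_mat_carrier[of n X es] in \<open>auto simp: greedy_coeff_def Let_def\<close>)

text \<open>With \<open>A\<close> the basis matrix, \<open>A\<^sup>T X (z + A \<alpha>) = - \<alpha> + (A\<^sup>T X A) \<alpha> = 0\<close>. If the residual
  were zero, then \<open>z = A (- \<alpha>)\<close> would lie in the column space.\<close>
lemma greedy_residual:
  assumes X: "sym_pos_def (2 * n) X" and es: "isotropic_orthonormal n X es"
    and z: "z \<in> carrier_vec (2 * n)"
  defines "r \<equiv> z + greedy_mat n X es *\<^sub>v greedy_coeff n X es z"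
  shows "r \<in> carrier_vec (2 * n)"
    "\<And>i. i < length es \<Longrightarrow> es ! i \<bullet> (X *\<^sub>v r) = 0"
    "\<And>i. i < length es \<Longrightarrow> (T_mat n X *\<^sub>v es ! i) \<bullet> (X *\<^sub>v r) = 0"
    "z \<notin> vec_space.col_space (2 * n) (greedy_mat n X es) \<Longrightarrow> r \<noteq> 0\<^sub>v (2 * n)"
proof -
  let ?G = "greedy_mat n X es" and ?k = "length es" and ?a = "greedy_coeff n X es z"
  note G = greedy_mat_carrier[of n X es]
  note X' = sym_pos_defD[OF X]
  have c: "set es \<subseteq> carrier_vec (2 * n)" using es by (simp add: isotropic_orthonormal_def)
  have a: "?a \<in> carrier_vec (2 * ?k)"
    by (auto simp: greedy_coeff_def Let_def)
  show r: "r \<in> carrier_vec (2 * n)" unfolding r_def using z G a by (intro add_carrier_vec mult_mat_vec_carrier)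
  have Gz: "transpose_mat ?G *\<^sub>v (X *\<^sub>v z) = - ?a"
    by (simp add: greedy_coeff_eq_projection[OF X c z])
  have "transpose_mat ?G *\<^sub>v (X *\<^sub>v (?G *\<^sub>v ?a)) = (transpose_mat ?G * X * ?G) *\<^sub>v ?a"
    using G X'(1) a by (simp add: assoc_mult_mat_vec[of _ "2 * ?k" "2 * n" _ "2 * ?k"]
      assoc_mult_mat_vec[of _ "2 * ?k" "2 * n" _ "2 * n"] del: assoc_mult_mat)
  also have "\<dots> = ?a"
    using a by (simp add: isotropic_orthonormal_imp_greedy_mat_orthonormal[OF X es])
  finally have "transpose_mat ?G *\<^sub>v (X *\<^sub>v r) = - ?a + ?a"
    unfolding r_def using G X'(1) a z Gz
    by (simp add: mult_add_distrib_mat_vec[of _ "2 * n" "2 * n"]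
        mult_add_distrib_mat_vec[of _ "2 * ?k" "2 * n"])
  then have Gr: "transpose_mat ?G *\<^sub>v (X *\<^sub>v r) = 0\<^sub>v (2 * ?k)" using a by simp
  have col: "col ?G i \<bullet> (X *\<^sub>v r) = 0" if "i < 2 * ?k" for i
    using arg_cong[OF Gr, of "\<lambda>x. x $ i"] that G by simp
  show "es ! i \<bullet> (X *\<^sub>v r) = 0" if "i < ?k" for i
    using col[of i] col_greedy_mat[OF X c, of i] that by simp
  show "(T_mat n X *\<^sub>v es ! i) \<bullet> (X *\<^sub>v r) = 0" if "i < ?k" for i
    using col[of "?k + i"] col_greedy_mat[OF X c, of "?k + i"] that by simp
  show "r \<noteq> 0\<^sub>v (2 * n)" if "z \<notin> vec_space.col_space (2 * n) ?G"
  proof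
    assume "r = 0\<^sub>v (2 * n)"
    then have sum: "(z + ?G *\<^sub>v ?a) $ i = 0" if "i < 2 * n" for i
      using that by (simp add: r_def)
    have "z = ?G *\<^sub>v (- ?a)"
    proof (rule eq_vecI)
      fix i assume "i < dim_vec (?G *\<^sub>v (- ?a))"
      then have i: "i < 2 * n" using G by simp
      then show "z $ i = (?G *\<^sub>v (- ?a)) $ i"
        using sum[OF i] G a z by simp
    qed (use z G in auto)
    then have "z \<in> vec_space.col_space (2 * n) ?G"
      using z G uminus_carrier_vec[of ?a "2 * ?k"] a
      by (subst vec_space.col_space_eq[OF G]) (metis (mono_tags, lifting) carrier_matD mem_Collect_eq)
    then show False using that by simp
  qed
qed

lemma X_normalize:
  assumes X: "sym_pos_def m X" and v: "v \<in> carrier_vec m" "v \<noteq> 0\<^sub>v m"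
  shows "X_normalize X v \<in> carrier_vec m"
    "X_normalize X v \<bullet> (X *\<^sub>v X_normalize X v) = 1"
    "\<And>x. x \<in> carrier_vec m \<Longrightarrow> x \<bullet> (X *\<^sub>v v) = 0 \<Longrightarrow> x \<bullet> (X *\<^sub>v X_normalize X v) = 0"
proof -
  note X' = sym_pos_defD[OF X]
  have Xv: "X *\<^sub>v X_normalize X v = (1 / X_norm X v) \<cdot>\<^sub>v (X *\<^sub>v v)"
    unfolding X_normalize_def by (rule mult_mat_vec[OF X'(1) v(1)])
  show "X_normalize X v \<in> carrier_vec m" using v by (simp add: X_normalize_def)
  show "X_normalize X v \<bullet> (X *\<^sub>v X_normalize X v) = 1"
    unfolding Xv using X'(3)[OF v] v X'(1) by (simp add: X_normalize_def X_norm_def)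
  show "x \<bullet> (X *\<^sub>v X_normalize X v) = 0" if "x \<in> carrier_vec m" "x \<bullet> (X *\<^sub>v v) = 0" for x
    unfolding Xv using that v X'(1) by simp
qed

text \<open>Orthogonality of \<open>e\<close> to the \<open>T e\<^sub>i\<close> yields orthogonality of \<open>T e\<close> to the \<open>e\<^sub>i\<close>, and
  \<open>\<langle>e, T e\<rangle> = - \<langle>e, T e\<rangle>\<close> vanishes, both by skewness of \<open>T\<close>.\<close>
lemma isotropic_orthonormal_snoc:
  assumes X: "sym_pos_def (2 * n) X" and es: "isotropic_orthonormal n X es"
    and e: "e \<in> carrier_vec (2 * n)" "e \<bullet> (X *\<^sub>v e) = 1"
    and orth: "\<And>i. i < length es \<Longrightarrow> es ! i \<bullet> (X *\<^sub>v e) = 0"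
      "\<And>i. i < length es \<Longrightarrow> (T_mat n X *\<^sub>v es ! i) \<bullet> (X *\<^sub>v e) = 0"
  shows "isotropic_orthonormal n X (es @ [e])"
proof -
  let ?k = "length es"
  note X' = sym_pos_defD[OF X]
  have c: "es ! i \<in> carrier_vec (2 * n)" if "i < ?k" for i
    using es that by (auto simp: isotropic_orthonormal_def)
  have "e \<bullet> (X *\<^sub>v es ! i) = 0" if "i < ?k" for i
    using symmetric_form_commute[OF X'(1,2) e(1) c[OF that]] orth(1)[OF that] by simp
  moreover have eT: "e \<bullet> (X *\<^sub>v (T_mat n X *\<^sub>v es ! i)) = 0" if "i < ?k" for i
    using symmetric_form_commute[OF X'(1,2) e(1) T_mult_carrier[OF X c[OF that]]]
      orth(2)[OF that] by simp
  moreover have "es ! i \<bullet> (X *\<^sub>v (T_mat n X *\<^sub>v e)) = 0" if "i < ?k" for i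
    using X_form_T_skew[OF X c[OF that] e(1)] eT[OF that] by simp
  moreover have "e \<bullet> (X *\<^sub>v (T_mat n X *\<^sub>v e)) = 0"
    using X_form_T_skew[OF X e(1) e(1)] by simp
  ultimately show ?thesis
    using es e orth(1)
    by (auto simp: isotropic_orthonormal_def nth_append less_Suc_eq)
qed

lemma greedy_vectors_isotropic_orthonormal:
  assumes X: "sym_pos_def (2 * n) X" and "greedy_vectors n X k es"
  shows "length es = k \<and> isotropic_orthonormal n X es"
  using assms(2)
proof induction
  case (start z0)
  \<comment> \<open>The first vector extends the empty family, so the start is an instance of the same lemma.\<close>
  have "isotropic_orthonormal n X []" by (simp add: isotropic_orthonormal_def)
  from isotropic_orthonormal_snoc[OF X this, of "X_normalize X z0"] start
  show ?case using X_normalize[OF X] by simp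
next
  case (step k es z)
  let ?r = "z + greedy_mat n X es *\<^sub>v greedy_coeff n X es z"
  have es: "isotropic_orthonormal n X es" and k: "length es = k" using step.IH by auto
  then have c: "es ! i \<in> carrier_vec (2 * n)" if "i < length es" for i
    using that by (auto simp: isotropic_orthonormal_def)
  note r = greedy_residual[OF X es step.hyps(2)]
  note e = X_normalize[OF X r(1) r(4)[OF step.hyps(3)]]
  have "isotropic_orthonormal n X (es @ [X_normalize X ?r])"
    by (rule isotropic_orthonormal_snoc[OF X es e(1,2)])
      (auto intro: e(3) r(2,3) c T_mult_carrier[OF X])
  then show ?case using k by simp
qed

theorem theorem4p4:
  fixes n k :: nat and X :: "real mat" and es :: "real vec list"
  assumes "sym_pos_def (2 * n) X"
    and "1 \<le> k"
    and "greedy_vectors n X k es"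
  shows "transpose_mat (greedy_mat n X es) * X * greedy_mat n X es = 1\<^sub>m (2 * k)"
  using isotropic_orthonormal_imp_greedy_mat_orthonormal[OF assms(1)]
    greedy_vectors_isotropic_orthonormal[OF assms(1,3)] by auto

end
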